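(* Let $(X,r)$ be an irretractable non-degenerate set-theoretic solution of the Yang--Baxter equation. Then $r$ is bijective.
   Context: A set-theoretic solution of the Yang--Baxter equation (YBE) is a pair $(X,r)$ with $X$ a non-empty set (possibly infinite) and $r\colon X\times X\to X\times X$ a map (not assumed bijective) such that $(r\times \mathrm{id}_X)\circ(\mathrm{id}_X\times r)\circ(r\times \mathrm{id}_X)=(\mathrm{id}_X\times r)\circ(r\times \mathrm{id}_X)\circ(\mathrm{id}_X\times r)$. Write $r(x,y)=(\sigma_x(y),\gamma_y(x))$. The solution is non-degenerate if all maps $\sigma_x\colon X\to X$ and all maps $\gamma_y\colon X\to X$ are bijective. The solution is irretractable if, for all $x,y\in X$, $\sigma_x=\sigma_y$ implies $x=y$. *)

theory Defs
  imports Main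
begin

text \<open>
  The underlying non-empty set \<open>X\<close> is the universe of the type \<open>'a\<close>, which may be infinite.
  The triple product \<open>X \<times> X \<times> X\<close> is nested to the right in HOL, so \<open>r \<times> id\<close> needs an explicit
  reassociation, whereas \<open>id \<times> r\<close> is literally \<open>map_prod id r\<close>.
\<close>

definition apply12 :: "('a \<times> 'a \<Rightarrow> 'a \<times> 'a) \<Rightarrow> 'a \<times> 'a \<times> 'a \<Rightarrow> 'a \<times> 'a \<times> 'a" where
  "apply12 r = (\<lambda>(x, y, z). case r (x, y) of (u, v) \<Rightarrow> (u, v, z))"

definition apply23 :: "('a \<times> 'a \<Rightarrow> 'a \<times> 'a) \<Rightarrow> 'a \<times> 'a \<times> 'a \<Rightarrow> 'a \<times> 'a \<times> 'a" where
  "apply23 r = map_prod id r"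

definition ybe_solution :: "('a \<times> 'a \<Rightarrow> 'a \<times> 'a) \<Rightarrow> bool" where
  "ybe_solution r \<longleftrightarrow>
     apply12 r \<circ> apply23 r \<circ> apply12 r = apply23 r \<circ> apply12 r \<circ> apply23 r"

text \<open>The component maps are determined by \<open>r (x, y) = (sigma r x y, gamma r y x)\<close>.\<close>

definition sigma :: "('a \<times> 'a \<Rightarrow> 'a \<times> 'a) \<Rightarrow> 'a \<Rightarrow> 'a \<Rightarrow> 'a" where
  "sigma r x y = fst (r (x, y))"

definition gamma :: "('a \<times> 'a \<Rightarrow> 'a \<times> 'a) \<Rightarrow> 'a \<Rightarrow> 'a \<Rightarrow> 'a" where
  "gamma r y x = snd (r (x, y))"

definition non_degenerate :: "('a \<times> 'a \<Rightarrow> 'a \<times> 'a) \<Rightarrow> bool" where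
  "non_degenerate r \<longleftrightarrow> (\<forall>x. bij (sigma r x)) \<and> (\<forall>y. bij (gamma r y))"

definition irretractable :: "('a \<times> 'a \<Rightarrow> 'a \<times> 'a) \<Rightarrow> bool" where
  "irretractable r \<longleftrightarrow> (\<forall>x y. sigma r x = sigma r y \<longrightarrow> x = y)"

end

theory Submission
  imports Defs
begin

text \<open>
  Write \<open>\<sigma>\<^sub>x\<close> and \<open>\<gamma>\<^sub>y\<close> for the component maps of \<open>r\<close>. The first component of the
  Yang--Baxter equation says that \<open>r (x, a) = (y, t)\<close> implies \<open>\<sigma>\<^sub>x \<circ> \<sigma>\<^sub>a = \<sigma>\<^sub>y \<circ> \<sigma>\<^sub>t\<close>. Since
  the \<open>\<sigma>\<close> are bijective and irretractability recovers a point from its \<open>\<sigma>\<close>, it follows that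
  \<open>x = y\<close> if and only if \<open>a = t\<close>: a pair whose first or second entry is preserved by \<open>r\<close> is a
  fixed point of \<open>r\<close>. That is, \<open>\<sigma>\<^sub>x z = x\<close> holds exactly when \<open>\<gamma>\<^sub>z x = z\<close> does
  (lemma \<open>sigma_fixes_iff_gamma_fixes\<close>). With non-degeneracy, this makes the fixed
  points of \<open>r\<close> the graph of a bijection \<open>x \<mapsto> z\<close> of \<open>X\<close>: the bijectivity of \<open>\<sigma>\<^sub>x\<close> determines
  \<open>z\<close> from \<open>x\<close>, and that of \<open>\<gamma>\<^sub>z\<close> determines \<open>x\<close> from \<open>z\<close>.

  This bijection inverts \<open>r\<close>. If \<open>r (x, a) = (y, t)\<close> and \<open>(a, z)\<close> is the fixed point
  over \<open>a\<close>, then \<open>\<sigma>\<^sub>y (\<sigma>\<^sub>t z) = \<sigma>\<^sub>x (\<sigma>\<^sub>a z) = \<sigma>\<^sub>x a = y\<close>, so \<open>z\<close> is determined by \<open>(y, t)\<close>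
  alone. Then \<open>z\<close> determines \<open>a\<close>, and \<open>x\<close> is the preimage of \<open>t\<close> under \<open>\<gamma>\<^sub>a\<close>. The same
  recipe, read as a construction, gives a preimage of any \<open>(y, t)\<close>.
\<close>

lemma apply_eq_sigma_gamma: "r (x, y) = (sigma r x y, gamma r y x)"
  by (simp add: sigma_def gamma_def)

lemma sigma_sigma_eq:
  assumes "ybe_solution r"
  shows "sigma r x (sigma r y z) = sigma r (sigma r x y) (sigma r (gamma r y x) z)"
proof -
  have "(apply12 r \<circ> apply23 r \<circ> apply12 r) (x, y, z)
      = (apply23 r \<circ> apply12 r \<circ> apply23 r) (x, y, z)"
    using assms by (simp add: ybe_solution_def)
  then show ?thesis
    by (simp add: apply12_def apply23_def apply_eq_sigma_gamma)
qed

lemma sigma_eq_iff: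
  assumes "non_degenerate r"
  shows "sigma r x y = sigma r x z \<longleftrightarrow> y = z"
  using assms by (simp add: non_degenerate_def bij_is_inj inj_eq)

lemma gamma_eq_iff:
  assumes "non_degenerate r"
  shows "gamma r y x = gamma r y z \<longleftrightarrow> x = z"
  using assms by (simp add: non_degenerate_def bij_is_inj inj_eq)

lemma obtain_sigma_preimage:
  assumes "non_degenerate r"
  obtains z where "sigma r x z = y"
  using assms unfolding non_degenerate_def by (metis bij_pointE)

lemma obtain_gamma_preimage:
  assumes "non_degenerate r"
  obtains x where "gamma r z x = y"
  using assms unfolding non_degenerate_def by (metis bij_pointE)

text \<open>
  In \<open>\<sigma>\<^sub>x \<circ> \<sigma>\<^sub>z = \<sigma>\<^sub>y \<circ> \<sigma>\<^sub>t\<close> with \<open>(y, t) = r (x, z)\<close>, one can cancel \<open>\<sigma>\<^sub>x = \<sigma>\<^sub>y\<close> on the left if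
  \<open>y = x\<close>, and \<open>\<sigma>\<^sub>z = \<sigma>\<^sub>t\<close> on the right, by surjectivity, if \<open>t = z\<close>. Irretractability turns
  the remaining equality of maps into one of points.
\<close>

lemma sigma_fixes_iff_gamma_fixes:
  assumes ybe: "ybe_solution r" and nd: "non_degenerate r" and irr: "irretractable r"
  shows "sigma r x z = x \<longleftrightarrow> gamma r z x = z"
proof
  assume fix_x: "sigma r x z = x"
  have "sigma r (gamma r z x) = sigma r z"
  proof
    show "sigma r (gamma r z x) w = sigma r z w" for w
      using sigma_sigma_eq[OF ybe, of x z w] by (simp add: fix_x sigma_eq_iff[OF nd])
  qed
  then show "gamma r z x = z"
    using irr unfolding irretractable_def by blast
next
  assume fix_z: "gamma r z x = z"
  have "sigma r (sigma r x z) = sigma r x"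
  proof
    fix w
    obtain v where "sigma r z v = w" by (rule obtain_sigma_preimage[OF nd])
    then show "sigma r (sigma r x z) w = sigma r x w"
      using sigma_sigma_eq[OF ybe, of x z v] by (simp add: fix_z)
  qed
  then show "sigma r x z = x"
    using irr unfolding irretractable_def by blast
qed

text \<open>
  Passing to the equation \<open>\<gamma>\<^sub>z x = z\<close> brings in the injectivity of \<open>\<gamma>\<^sub>z\<close>; the equation
  \<open>\<sigma>\<^sub>x z = x\<close> by itself, where \<open>x\<close> occurs as an index, would not determine \<open>x\<close>.
\<close>

lemma sigma_fixes_unique:
  assumes "ybe_solution r" and nd: "non_degenerate r" and "irretractable r"
    and "sigma r x z = x" and "sigma r y z = y"
  shows "x = y"
  using assms sigma_fixes_iff_gamma_fixes[OF assms(1-3)] gamma_eq_iff[OF nd, of z x y]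
  by simp

theorem theorem4p5:
  fixes r :: "'a \<times> 'a \<Rightarrow> 'a \<times> 'a"
  assumes "ybe_solution r"
    and "non_degenerate r"
    and "irretractable r"
  shows "bij r"
proof (rule bijI)
  note fixes_iff = sigma_fixes_iff_gamma_fixes[OF assms]
    and fixes_unique = sigma_fixes_unique[OF assms]
    and sigma_sigma = sigma_sigma_eq[OF assms(1)]
  show "inj r"
  proof (rule injI, clarify)
    fix x a x' a' assume "r (x, a) = r (x', a')"
    then have y: "sigma r x a = sigma r x' a'" and t: "gamma r a x = gamma r a' x'"
      by (simp_all add: apply_eq_sigma_gamma)
    obtain z where z: "sigma r a z = a" by (rule obtain_sigma_preimage[OF assms(2)])
    have "sigma r x' (sigma r a' z) = sigma r x (sigma r a z)"
      using sigma_sigma[of x' a' z] sigma_sigma[of x a z] by (simp only: y t)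
    also have "\<dots> = sigma r x' a'"
      by (simp add: z y)
    finally have "sigma r a' z = a'"
      by (simp add: sigma_eq_iff[OF assms(2)])
    with z have "a = a'" by (rule fixes_unique)
    then show "x = x' \<and> a = a'"
      using t by (simp add: gamma_eq_iff[OF assms(2)])
  qed
  show "surj r"
  proof (unfold surj_def, rule allI)
    fix p :: "'a \<times> 'a"
    obtain y t where p: "p = (y, t)" by (cases p)
    obtain c where c: "sigma r y c = y" by (rule obtain_sigma_preimage[OF assms(2)])
    obtain z where z: "sigma r t z = c" by (rule obtain_sigma_preimage[OF assms(2)])
    obtain a where "gamma r z a = z" by (rule obtain_gamma_preimage[OF assms(2)])
    then have a: "sigma r a z = a" by (simp add: fixes_iff)
    obtain x where x: "gamma r a x = t" by (rule obtain_gamma_preimage[OF assms(2)])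
    \<comment> \<open>The first entry of \<open>r (x, a)\<close> and \<open>y\<close> have fixed points of \<open>r\<close> over them with the same
      second entry \<open>c\<close>, hence coincide.\<close>
    have "sigma r (sigma r x a) c = sigma r x a"
      using sigma_sigma[of x a z] by (simp add: a x z)
    then have "sigma r x a = y" using c by (rule fixes_unique)
    then show "\<exists>q. p = r q"
      using x p by (metis apply_eq_sigma_gamma)
  qed
qed

end
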